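(* Let $m \ge n\ge 4$ and $k\ge 1$ be integers, and let $K_{n,m}$ be the complete bipartite graph with parts of sizes $n$ and $m$. Then \[\ddot{\gamma}_P^k(K_{n,m}) \le \begin{cases} 2(k+1)+(m-n-4)\left\lfloor \frac{k}{n+2}\right\rfloor & \text{if } k \equiv i \pmod{n+2} \text{ for some } 0\le i\le n-4,\\[4pt] k+m-1 +(m-2)\left\lfloor\frac{k}{n+2}\right\rfloor & \text{otherwise.} \end{cases}\]
   Context: Graphs are finite and simple. For a vertex $v$, $N[v]$ denotes its closed neighborhood. The power domination process on a graph $G$ with initial set $S\subseteq V(G)$: (1) set $B=\bigcup_{v\in S}N[v]$; (2) while there is $v\in B$ with exactly one neighbor $u\notin B$, add $u$ to $B$. A set $S$ is a power dominating set of $G$ if $B=V(G)$ when the process terminates. A multiset of vertices is called a power dominating set if its underlying set is one. For an integer $k\ge 0$, a $k$-robust power dominating set of $G$ is a finite multiset $S$ of elements of $V(G)$ with $|S|\ge k$ (counted with multiplicity) such that for every submultiset $F$ of $S$ with $|F|=k$, the multiset difference $S\setminus F$ is a power dominating set of $G$. $\ddot{\gamma}_P^k(G)$ denotes the minimum cardinality (with multiplicity) of a $k$-robust power dominating set of $G$. *)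

theory Defs
  imports
    "Graph_Theory.Kuratowski"
    "HOL-Library.Multiset"
    "HOL-Number_Theory.Cong"
    Complex_Main
begin

text \<open>
  A finite simple graph is a \<open>graph\<close> of \<open>Graph_Theory\<close>: a finite symmetric digraph without
  loops or parallel arcs. Adjacency of \<open>u\<close> and \<open>v\<close> is \<open>u \<rightarrow>\<^bsub>G\<^esub> v\<close>, and the complete bipartite
  graphs are the library's \<open>K\<^bsub>n,m\<^esub>\<close>.
\<close>

definition closed_nbhd :: "('a,'b) pre_digraph \<Rightarrow> 'a \<Rightarrow> 'a set" where
  "closed_nbhd G v = insert v {u \<in> verts G. v \<rightarrow>\<^bsub>G\<^esub> u}"

definition pd_step :: "('a,'b) pre_digraph \<Rightarrow> 'a set \<Rightarrow> 'a set \<Rightarrow> bool" where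
  "pd_step G B B' \<longleftrightarrow>
     (\<exists>v\<in>B. \<exists>u. {w \<in> verts G. v \<rightarrow>\<^bsub>G\<^esub> w \<and> w \<notin> B} = {u} \<and> B' = insert u B)"

text \<open>
  The process may have several forces available at a time, so it is a nondeterministic
  reduction. By \<open>pd_terminates_in_ex1\<close> below, on a finite vertex set it always stops, and the
  set in which it stops does not depend on the choices made.
\<close>

definition pd_terminates_in :: "('a,'b) pre_digraph \<Rightarrow> 'a set \<Rightarrow> 'a set \<Rightarrow> bool" where
  "pd_terminates_in G S B \<longleftrightarrow>
     (pd_step G)\<^sup>*\<^sup>* (\<Union>v\<in>S. closed_nbhd G v) B \<and> (\<nexists>B'. pd_step G B B')"

definition power_dominating :: "('a,'b) pre_digraph \<Rightarrow> 'a set \<Rightarrow> bool" where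
  "power_dominating G S \<longleftrightarrow> S \<subseteq> verts G \<and> pd_terminates_in G S (verts G)"

definition robust_power_dominating ::
    "('a,'b) pre_digraph \<Rightarrow> nat \<Rightarrow> 'a multiset \<Rightarrow> bool" where
  "robust_power_dominating G k S \<longleftrightarrow>
     set_mset S \<subseteq> verts G \<and> k \<le> size S \<and>
     (\<forall>F. F \<subseteq># S \<and> size F = k \<longrightarrow> power_dominating G (set_mset (S - F)))"

text \<open>
  The set of sizes minimised here is nonempty for every finite nonempty vertex set, by
  \<open>robust_power_dominating_ex\<close> below.
\<close>

definition robust_power_domination_number :: "('a,'b) pre_digraph \<Rightarrow> nat \<Rightarrow> nat" where
  "robust_power_domination_number G k =
     (LEAST t. \<exists>S. robust_power_dominating G k S \<and> size S = t)"

lemma pd_steps_subset_terminal: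
  assumes "(pd_step G)\<^sup>*\<^sup>* B C" "B \<subseteq> T" "\<nexists>T'. pd_step G T T'"
  shows "C \<subseteq> T"
  using assms(1,2)
proof (induction rule: rtranclp_induct)
  case base
  then show ?case by simp
next
  case (step C D)
  then have CT: "C \<subseteq> T" by simp
  from step.hyps(2) obtain v u where v: "v \<in> C"
    and u: "{w \<in> verts G. v \<rightarrow>\<^bsub>G\<^esub> w \<and> w \<notin> C} = {u}" and D: "D = insert u C"
    by (auto simp: pd_step_def)
  have "u \<in> T"
  proof (rule ccontr)
    assume "u \<notin> T"
    with u CT have "{w \<in> verts G. v \<rightarrow>\<^bsub>G\<^esub> w \<and> w \<notin> T} = {u}" by blast
    with v CT have "pd_step G T (insert u T)" unfolding pd_step_def by blast
    with assms(3) show False by blast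
  qed
  with CT D show ?case by blast
qed

lemma pd_steps_mono: "(pd_step G)\<^sup>*\<^sup>* B C \<Longrightarrow> B \<subseteq> C"
  by (induction rule: rtranclp_induct) (auto simp: pd_step_def)

lemma pd_run_exists:
  assumes "finite (verts G)"
  shows "\<exists>C. (pd_step G)\<^sup>*\<^sup>* B C \<and> (\<nexists>C'. pd_step G C C')"
proof (induction "card (verts G - B)" arbitrary: B rule: less_induct)
  case less
  show ?case
  proof (cases "\<exists>B'. pd_step G B B'")
    case False
    then show ?thesis by blast
  next
    case True
    then obtain B' where B': "pd_step G B B'" by blast
    then obtain u where "u \<in> verts G" "u \<notin> B" "B' = insert u B"
      unfolding pd_step_def by blast
    then have "verts G - B' \<subset> verts G - B" by blast
    with assms have "card (verts G - B') < card (verts G - B)"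
      by (simp add: psubset_card_mono)
    from less[OF this] B' show ?thesis by (meson converse_rtranclp_into_rtranclp)
  qed
qed

lemma pd_terminates_in_ex1:
  assumes "finite (verts G)"
  shows "\<exists>!B. pd_terminates_in G S B"
proof -
  obtain B where B: "pd_terminates_in G S B"
    using pd_run_exists[OF assms] unfolding pd_terminates_in_def by blast
  moreover have "B' = B" if "pd_terminates_in G S B'" for B'
  proof
    show "B' \<subseteq> B"
      using that B pd_steps_subset_terminal pd_steps_mono
      unfolding pd_terminates_in_def by metis
    show "B \<subseteq> B'"
      using that B pd_steps_subset_terminal pd_steps_mono
      unfolding pd_terminates_in_def by metis
  qed
  ultimately show ?thesis by blast
qed

lemma power_dominating_verts: "power_dominating G (verts G)"
proof -
  have "(\<Union>v\<in>verts G. closed_nbhd G v) = verts G" by (auto simp: closed_nbhd_def)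
  moreover have "\<nexists>B'. pd_step G (verts G) B'" by (auto simp: pd_step_def)
  ultimately show ?thesis by (simp add: power_dominating_def pd_terminates_in_def)
qed

lemma robust_power_dominating_ex:
  assumes "finite (verts G)" "verts G \<noteq> {}"
  shows "\<exists>S. robust_power_dominating G k S"
proof -
  define S where "S = repeat_mset (Suc k) (mset_set (verts G))"
  have cnt: "count S v = (if v \<in> verts G then Suc k else 0)" for v
    using assms by (simp add: S_def)
  have set: "set_mset S = verts G"
    by (auto simp: set_mset_def cnt)
  have "set_mset (S - F) = verts G" if "size F = k" for F
  proof -
    have "count F v \<le> k" for v using that by (metis count_le_size)
    then have "count (S - F) v > 0 \<longleftrightarrow> v \<in> verts G" for v
      by (auto simp: cnt le_imp_less_Suc)
    then show ?thesis by (simp add: set_mset_def)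
  qed
  moreover have "k \<le> size S"
  proof -
    from assms obtain v where "v \<in> verts G" by blast
    then have "Suc k \<le> size S" using cnt[of v] count_le_size[of S v] by simp
    then show ?thesis by simp
  qed
  ultimately show ?thesis
    using set by (auto simp: robust_power_dominating_def power_dominating_verts)
qed

end

theory Submission
  imports Defs
begin

text \<open>
  A nonempty set of vertices of \<open>K\<^bsub>n,m\<^esub>\<close> is power dominating as soon as it meets both parts or misses
  at most one vertex of a part. Hence to destroy a multiset one has to remove everything from one
  part together with all copies of two vertices of the other part. It therefore suffices that for
  each part the number of tokens there, plus the number of tokens on any two vertices of the
  opposite part, exceeds \<open>k\<close>. With \<open>k = q (n + 2) + i\<close>, spread tokens
  evenly within each part: \<open>n q + i + 1\<close> and \<open>m q + i + 1\<close> tokens if \<open>i \<le> n - 4\<close>, and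
  \<open>n q + i - 1\<close> and \<open>m (q + 1)\<close> tokens otherwise.
\<close>

text \<open>A vertex of \<open>S\<close> in \<open>U\<close> dominates all of \<open>V\<close> at
  once. If \<open>S\<close> also meets \<open>V\<close>, nothing is left; otherwise one forcing step
  suffices. The parts play different roles here, so that the lemma can be applied with them
  swapped.\<close>

lemma power_dominating_bipartiteI:
  assumes verts: "verts G = U \<union> V" and arcs: "arcs_ends G = U \<times> V \<union> V \<times> U"
    and S: "S \<subseteq> U \<union> V" "S \<inter> U \<noteq> {}" and V: "V \<noteq> {}"
    and large: "\<And>x y. S \<inter> V = {} \<Longrightarrow> x \<in> U - S \<Longrightarrow> y \<in> U - S \<Longrightarrow> x = y"
  shows "power_dominating G S"
proof -
  define B where "B = (\<Union>v\<in>S. closed_nbhd G v)"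
  have B_verts: "B \<subseteq> verts G"
    using S(1) by (auto simp: B_def closed_nbhd_def verts)
  have S_B: "S \<subseteq> B" by (auto simp: B_def closed_nbhd_def)
  have V_B: "V \<subseteq> B"
  proof -
    obtain s where s: "s \<in> S" "s \<in> U" using S(2) by blast
    then have "V \<subseteq> closed_nbhd G s" by (auto simp: closed_nbhd_def verts arcs)
    with s(1) show ?thesis unfolding B_def by blast
  qed
  have U_B: "U \<subseteq> B" if "S \<inter> V \<noteq> {}"
  proof -
    obtain s where s: "s \<in> S" "s \<in> V" using \<open>S \<inter> V \<noteq> {}\<close> by blast
    then have "U \<subseteq> closed_nbhd G s" by (auto simp: closed_nbhd_def verts arcs)
    with s(1) show ?thesis unfolding B_def by blast
  qed
  have "(pd_step G)\<^sup>*\<^sup>* B (verts G)"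
  proof (cases "B = verts G")
    case True
    then show ?thesis by simp
  next
    case False
    then obtain u where u: "u \<in> U" "u \<notin> B"
      using B_verts V_B unfolding verts by blast
    have miss: "w = u" if "w \<in> verts G" "w \<notin> B" for w
    proof (rule large)
      show "S \<inter> V = {}" using u U_B by auto
      show "w \<in> U - S" using that S_B V_B verts by auto
      show "u \<in> U - S" using u S_B by auto
    qed
    obtain v where v: "v \<in> V" using V by blast
    \<comment> \<open>Any \<open>v\<close> in \<open>V\<close> is adjacent to all of
      \<open>U\<close>, so the only vertex missing from \<open>B\<close> is its unique neighbor
      outside \<open>B\<close>.\<close>
    have "{w \<in> verts G. v \<rightarrow>\<^bsub>G\<^esub> w \<and> w \<notin> B} = {u}"
    proof
      show "{w \<in> verts G. v \<rightarrow>\<^bsub>G\<^esub> w \<and> w \<notin> B} \<subseteq> {u}" using miss by auto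
      show "{u} \<subseteq> {w \<in> verts G. v \<rightarrow>\<^bsub>G\<^esub> w \<and> w \<notin> B}"
        using u v by (simp add: verts arcs)
    qed
    moreover have "verts G = insert u B"
    proof
      show "verts G \<subseteq> insert u B" using miss by auto
      show "insert u B \<subseteq> verts G" using u B_verts verts by simp
    qed
    moreover have "v \<in> B" using v V_B by auto
    ultimately have "pd_step G B (verts G)" unfolding pd_step_def by blast
    then show ?thesis by (rule r_into_rtranclp)
  qed
  moreover have "\<nexists>B'. pd_step G (verts G) B'" by (auto simp: pd_step_def)
  ultimately show ?thesis
    using S(1) unfolding power_dominating_def pd_terminates_in_def B_def verts[symmetric]
    by blast
qed

text \<open>Counting: an \<open>F\<close> that wipes out \<open>A\<close>, \<open>x\<close> and
  \<open>y\<close> contains all tokens of \<open>M\<close> there. In use, \<open>A\<close> is one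
  part and \<open>x\<close>, \<open>y\<close> lie in the other.\<close>

lemma mset_diff_meets:
  assumes "x \<noteq> y" "x \<notin> A" "y \<notin> A"
    and F: "size F < size {#z \<in># M. z \<in> A#} + count M x + count M y"
  shows "set_mset (M - F) \<inter> insert x (insert y A) \<noteq> {}"
proof
  assume "set_mset (M - F) \<inter> insert x (insert y A) = {}"
  then have gone: "count M z \<le> count F z" if "z \<in> insert x (insert y A)" for z
  proof -
    have "z \<notin># M - F" using that \<open>set_mset (M - F) \<inter> insert x (insert y A) = {}\<close> by blast
    then show ?thesis by (simp add: not_in_iff)
  qed
  \<comment> \<open>The three summands have disjoint supports, so the bound holds pointwise and
    their sizes add up.\<close>
  have "{#z \<in># M. z \<in> A#} + replicate_mset (count M x) x + replicate_mset (count M y) y \<subseteq># F"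
    unfolding subseteq_mset_def
  proof
    fix z
    show "count ({#z \<in># M. z \<in> A#} + replicate_mset (count M x) x
        + replicate_mset (count M y) y) z \<le> count F z"
      using assms(1-3) gone[of z] by (cases "z \<in> insert x (insert y A)") auto
  qed
  from size_mset_mono[OF this] F show False by simp
qed

lemma robust_power_dominating_bipartiteI:
  assumes verts: "verts G = U \<union> V" and disj: "U \<inter> V = {}"
    and arcs: "arcs_ends G = U \<times> V \<union> V \<times> U"
    and card: "2 \<le> card U" "2 \<le> card V"
    and M: "set_mset M \<subseteq> U" and N: "set_mset N \<subseteq> V"
    and U: "\<And>x y. x \<in> U \<Longrightarrow> y \<in> U \<Longrightarrow> x \<noteq> y \<Longrightarrow> k < size N + count M x + count M y"
    and V: "\<And>x y. x \<in> V \<Longrightarrow> y \<in> V \<Longrightarrow> x \<noteq> y \<Longrightarrow> k < size M + count N x + count N y"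
  shows "robust_power_dominating G k (M + N)"
proof -
  have two: "\<exists>x\<in>A. \<exists>y\<in>A. x \<noteq> y" if "2 \<le> card A" for A :: "'a set"
    using that by (meson card_2_iff' obtain_subset_with_card_n subsetD)
  have M0: "count M z = 0" if "z \<in> V" for z using that M disj by (metis disjoint_iff not_in_iff subsetD)
  have N0: "count N z = 0" if "z \<in> U" for z using that N disj by (metis disjoint_iff not_in_iff subsetD)
  have fU: "{#z \<in># M + N. z \<in> U#} = M"
    using M N disj by (auto simp: filter_mset_eq_conv simp del: filter_union_mset)
  have fV: "{#z \<in># M + N. z \<in> V#} = N"
    using M N disj by (auto simp: filter_mset_eq_conv simp del: filter_union_mset)
  \<comment> \<open>Two vertices of \<open>U\<close> carry at most \<open>size M\<close> tokens, so
    the hypothesis on \<open>U\<close> already bounds \<open>k\<close>.\<close>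
  have "k \<le> size (M + N)"
  proof -
    obtain x y where xy: "x \<in> U" "y \<in> U" "x \<noteq> y" using two card by blast
    then have "replicate_mset (count M x) x + replicate_mset (count M y) y \<subseteq># M"
      by (auto simp: subseteq_mset_def)
    from size_mset_mono[OF this] U[OF xy] show ?thesis by simp
  qed
  moreover have "power_dominating G (set_mset (M + N - F))" if F: "size F = k" for F
  proof -
    let ?S = "set_mset (M + N - F)"
    have sub: "?S \<subseteq> U \<union> V" using M N by (auto dest!: in_diffD)
    have mU: "?S \<inter> insert x (insert y V) \<noteq> {}" if "x \<in> U" "y \<in> U" "x \<noteq> y" for x y
      using that disj U[OF that] N0 F by (intro mset_diff_meets) (auto simp: fV simp del: filter_union_mset)
    have mV: "?S \<inter> insert x (insert y U) \<noteq> {}" if "x \<in> V" "y \<in> V" "x \<noteq> y" for x y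
      using that disj V[OF that] M0 F by (intro mset_diff_meets) (auto simp: fU simp del: filter_union_mset)
    show ?thesis
    proof (cases "?S \<inter> U = {}")
      \<comment> \<open>With no survivor in \<open>U\<close>, \<open>mV\<close> says that of any two
        vertices of \<open>V\<close> at least one survives. This gives both a survivor in
        \<open>V\<close> and at most one missing vertex.\<close>
      case True
      show ?thesis
      proof (rule power_dominating_bipartiteI)
        show "verts G = V \<union> U" "arcs_ends G = V \<times> U \<union> U \<times> V" "?S \<subseteq> V \<union> U"
          using verts arcs sub by auto
        show "?S \<inter> V \<noteq> {}" using two[OF card(2)] mV True by blast
        show "U \<noteq> {}" using card(1) by auto
        show "x = y" if "x \<in> V - ?S" "y \<in> V - ?S" for x y
          using that mV[of x y] True by blast
      qed
    next
      case False
      show ?thesis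
      proof (rule power_dominating_bipartiteI[OF verts arcs sub False])
        show "V \<noteq> {}" using card(2) by auto
        show "x = y" if "?S \<inter> V = {}" "x \<in> U - ?S" "y \<in> U - ?S" for x y
          using that mU[of x y] by blast
      qed
    qed
  qed
  ultimately show ?thesis using M N verts by (auto simp: robust_power_dominating_def)
qed

text \<open>Put \<open>q\<close> tokens on every vertex and one more on each of \<open>r\<close>
  vertices. At most \<open>card A - 2\<close> of these extras avoid a given pair, so the truncated
  term is 0 unless \<open>r\<close> is \<open>card A - 1\<close> or \<open>card A\<close>, where it
  is 1 or 2.\<close>

lemma balanced_mset_exists:
  assumes "finite A" "r \<le> card A"
  obtains M where "set_mset M \<subseteq> A" "size M = card A * q + r"
    "\<And>x y. x \<in> A \<Longrightarrow> y \<in> A \<Longrightarrow> x \<noteq> y \<Longrightarrow> 2 * q + (r + 2 - card A) \<le> count M x + count M y"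
proof -
  obtain T where T: "T \<subseteq> A" "card T = r" "finite T"
    using assms by (meson obtain_subset_with_card_n)
  define M where "M = repeat_mset q (mset_set A) + mset_set T"
  have cnt: "count M x = q + (if x \<in> T then 1 else 0)" if "x \<in> A" for x
    using that assms T by (simp add: M_def count_mset_set')
  show thesis
  proof
    show "set_mset M \<subseteq> A"
    proof
      fix x assume "x \<in># M"
      then have "0 < count M x" by simp
      then show "x \<in> A" using T assms by (auto simp: M_def count_mset_set' split: if_splits)
    qed
    show "size M = card A * q + r" using T by (simp add: M_def)
    fix x y assume xy: "x \<in> A" "y \<in> A" "x \<noteq> y"
    have "card ({x, y} \<inter> T) + card (A - {x, y}) \<ge> r"
    proof -
      have "r = card ({x, y} \<inter> T) + card (T - {x, y})"
        using T card_Int_Diff[of T "{x, y}"] by (simp add: Int_commute)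
      moreover have "card (T - {x, y}) \<le> card (A - {x, y})"
        using T assms by (intro card_mono) auto
      ultimately show ?thesis by simp
    qed
    moreover have "card (A - {x, y}) = card A - 2" "2 \<le> card A"
      using xy assms card_mono[of A "{x, y}"] by (auto simp: card_Diff_subset)
    ultimately show "2 * q + (r + 2 - card A) \<le> count M x + count M y"
      using xy by (auto simp: cnt split: if_splits)
  qed
qed

lemma robust_power_domination_number_le:
  assumes "robust_power_dominating G k S"
  shows "robust_power_domination_number G k \<le> size S"
  unfolding robust_power_domination_number_def using assms by (intro Least_le) blast

text \<open>Reduces the problem to arithmetic: \<open>q\<close>, \<open>r\<close> describe the
  balanced multiset on the part of size \<open>n\<close>, and \<open>p\<close>, \<open>s\<close> the
  one on the part of size \<open>m\<close>.\<close>

lemma robust_power_domination_number_bipartite_le: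
  assumes "K\<^bsub>n,m\<^esub> G" "2 \<le> n" "2 \<le> m" "r \<le> n" "s \<le> m"
    and "k < n * q + r + 2 * p + (s + 2 - m)"
    and "k < m * p + s + 2 * q + (r + 2 - n)"
  shows "robust_power_domination_number G k \<le> n * q + r + m * p + s"
proof -
  obtain U V where G: "verts G = U \<union> V" "U \<inter> V = {}" "card U = n" "card V = m"
    "arcs_ends G = U \<times> V \<union> V \<times> U"
    using assms(1) unfolding complete_bipartite_digraph_def by blast
  have fin: "finite U" "finite V"
    using G(3,4) assms(2,3) by (auto intro: card_ge_0_finite)
  obtain M where M: "set_mset M \<subseteq> U" "size M = n * q + r"
    "\<And>x y. x \<in> U \<Longrightarrow> y \<in> U \<Longrightarrow> x \<noteq> y \<Longrightarrow> 2 * q + (r + 2 - n) \<le> count M x + count M y"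
    using balanced_mset_exists[OF fin(1), of r q] assms(4) unfolding G(3) by blast
  obtain N where N: "set_mset N \<subseteq> V" "size N = m * p + s"
    "\<And>x y. x \<in> V \<Longrightarrow> y \<in> V \<Longrightarrow> x \<noteq> y \<Longrightarrow> 2 * p + (s + 2 - m) \<le> count N x + count N y"
    using balanced_mset_exists[OF fin(2), of s p] assms(5) unfolding G(4) by blast
  have "robust_power_dominating G k (M + N)"
  proof (rule robust_power_dominating_bipartiteI[OF G(1,2,5)])
    show "k < size N + count M x + count M y" if "x \<in> U" "y \<in> U" "x \<noteq> y" for x y
      using M(3)[OF that] N(2) assms(7) by linarith
    show "k < size M + count N x + count N y" if "x \<in> V" "y \<in> V" "x \<noteq> y" for x y
      using N(3)[OF that] M(2) assms(6) by linarith
  qed (use G(3,4) M(1) N(1) assms(2,3) in auto)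
  from robust_power_domination_number_le[OF this] show ?thesis using M(2) N(2) by simp
qed

theorem theorem4p6:
  fixes n m k :: nat and G :: "('a,'b) pre_digraph"
  assumes "m \<ge> n" and "n \<ge> 4" and "k \<ge> 1"
    and "K\<^bsub>n,m\<^esub> G"
  shows "int (robust_power_domination_number G k) \<le>
    (if \<exists>i. 0 \<le> i \<and> i \<le> n - 4 \<and> [k = i] (mod (n + 2))
     then 2 * (int k + 1) + (int m - int n - 4) * \<lfloor>real k / real (n + 2)\<rfloor>
     else int k + int m - 1 + (int m - 2) * \<lfloor>real k / real (n + 2)\<rfloor>)"
proof -
  define q i where "q = k div (n + 2)" and "i = k mod (n + 2)"
  have "q * (n + 2) + i = k" unfolding q_def i_def by (rule div_mult_mod_eq)
  then have k: "k = n * q + 2 * q + i" by (simp add: distrib_left mult.commute)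
  have i_less: "i < n + 2" by (simp add: i_def)
  have floor: "\<lfloor>real k / real (n + 2)\<rfloor> = int q"
    unfolding q_def by (rule floor_divide_of_nat_eq)
  \<comment> \<open>Since \<open>n - 4 < n + 2\<close>, the only candidate for the bound residue is
    the remainder of \<open>k\<close>.\<close>
  have residue: "(\<exists>i. 0 \<le> i \<and> i \<le> n - 4 \<and> [k = i] (mod (n + 2))) \<longleftrightarrow> i \<le> n - 4"
  proof
    assume "i \<le> n - 4"
    moreover have "[k = i] (mod (n + 2))" by (simp add: i_def cong_def)
    ultimately show "\<exists>i. 0 \<le> i \<and> i \<le> n - 4 \<and> [k = i] (mod (n + 2))" by blast
  qed (auto simp: cong_def i_def)
  have nm: "n * q \<le> m * q" using assms(1) by simp
  show ?thesis
  proof (cases "i \<le> n - 4")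
    case True
    \<comment> \<open>Here \<open>p = q\<close> and \<open>r = s = i + 1\<close>. Any pair holds at
      least \<open>2 * q\<close> tokens, so the extra 1 lifts both sums above \<open>k\<close>; the
      larger part needs \<open>nm\<close>.\<close>
    have "robust_power_domination_number G k \<le> n * q + (i + 1) + m * q + (i + 1)"
      by (rule robust_power_domination_number_bipartite_le[OF assms(4)])
        (use True assms nm k in linarith)+
    also have "int \<dots> = 2 * (int k + 1) + (int m - int n - 4) * int q"
      by (simp add: k algebra_simps)
    finally show ?thesis using True unfolding residue floor by simp
  next
    case False
    then have "1 \<le> i" by simp
    \<comment> \<open>Here \<open>p = q\<close>, \<open>r = i - 1\<close> and \<open>s = m\<close>.
      The full extra layer adds 2 to every pair in the larger part, which outweighs the lost 1. In
      the other inequality \<open>m\<close> exceeds \<open>i\<close> unless \<open>i\<close> is at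
      least \<open>n\<close>; then the pair term \<open>i + 1 - n\<close> makes up the difference.
      Also \<open>i \<le> n + 1\<close> gives \<open>r \<le> n\<close>.\<close>
    have "robust_power_domination_number G k \<le> n * q + (i - 1) + m * q + m"
      by (rule robust_power_domination_number_bipartite_le[OF assms(4)])
        (use \<open>1 \<le> i\<close> i_less assms nm k in linarith)+
    also have "int \<dots> = int k + int m - 1 + (int m - 2) * int q"
      using \<open>1 \<le> i\<close> by (simp add: k algebra_simps of_nat_diff)
    finally show ?thesis using False unfolding residue floor by simp
  qed
qed

end
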